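(* A metric space $X$ has asymptotic property C if and only if there is a sequence of integers $n_i\ge 0$, $i\ge 1$, such that for any sequence of positive real numbers $R_i$, $i\ge 1$, there is a finite sequence $\mathcal{V}_1,\dots,\mathcal{V}_n$ of uniformly bounded families of subsets of $X$ such that $\dim_{R_i}(\mathcal{V}_i)\le n_i$ for all $i\leq n$ and the members of $\mathcal{V}_1,\dots,\mathcal{V}_n$ together cover $X$.
   Context: A family of subsets of $X$ is uniformly bounded if the diameters of its members have a common finite upper bound. A family is $R$-disjoint if $d(x,y)\ge R$ whenever $x$ and $y$ belong to different elements of the family. For $U\subset X$ and $R\ge 0$, $B(U,R)$ consists of $U$ together with all points $x\in X$ such that $d(x,u)<R$ for some $u\in U$. The dimension of a family of subsets is the combinatorial dimension of its nerve, i.e. the supremum of all $k$ such that some $k+1$ members of the family have a common point. The dimension at scale $R$ of a family $\mathcal{U}$, denoted $\dim_R(\mathcal{U})$, is the dimension of the family $\{B(U,R)\}_{U\in\mathcal{U}}$ (indexed by $\mathcal{U}$). A metric space $X$ has asymptotic property C if for every sequence $R_1<R_2<\ldots$ of positive real numbers there exist $n\in\mathbb{N}$ and uniformly bounded families $\mathcal{U}_1,\dots,\mathcal{U}_n$ of subsets of $X$ such that $\mathcal{U}_i$ is $R_i$-disjoint for $1\le i\le n$ and the members of $\mathcal{U}_1,\dots,\mathcal{U}_n$ together cover $X$. The sequence is an arbitrary increasing sequence, and $n$ may depend on it. *)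

theory Defs
  imports "HOL-Analysis.Analysis"
begin

text \<open>Values are in the extended reals: an indexed family without a nonempty member has
  dimension \<open>Sup {} = - \<infinity>\<close>, and one with members of unbounded multiplicity has
  dimension \<open>\<infinity>\<close>. The \<open>k + 1\<close> members are counted by their indices, so equal sets with
  different indices count separately.\<close>

definition family_dim :: "'i set \<Rightarrow> ('i \<Rightarrow> 'a set) \<Rightarrow> ereal" where
  "family_dim I A =
     Sup {ereal (real k) | k. \<exists>J\<subseteq>I. card J = k + 1 \<and> (\<Inter>j\<in>J. A j) \<noteq> {}}"

context Metric_space
begin

definition ediameter :: "'a set \<Rightarrow> ereal" where
  "ediameter U = Sup {ereal (d x y) | x y. x \<in> U \<and> y \<in> U}"

definition uniformly_bounded :: "'a set set \<Rightarrow> bool" where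
  "uniformly_bounded \<U> \<longleftrightarrow> (\<exists>D::real. \<forall>U\<in>\<U>. ediameter U \<le> ereal D)"

definition disjoint_at_scale :: "real \<Rightarrow> 'a set set \<Rightarrow> bool" where
  "disjoint_at_scale R \<U> \<longleftrightarrow>
     (\<forall>U\<in>\<U>. \<forall>V\<in>\<U>. U \<noteq> V \<longrightarrow> (\<forall>x\<in>U. \<forall>y\<in>V. d x y \<ge> R))"

definition nbhd :: "'a set \<Rightarrow> real \<Rightarrow> 'a set" where
  "nbhd U R = U \<union> {x \<in> M. \<exists>u\<in>U. d x u < R}"

definition dim_at_scale :: "real \<Rightarrow> 'a set set \<Rightarrow> ereal" where
  "dim_at_scale R \<U> = family_dim \<U> (\<lambda>U. nbhd U R)"

text \<open>Sequences are indexed from \<open>1\<close>; their values at \<open>0\<close> are irrelevant.\<close>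

definition asymptotic_property_C :: bool where
  "asymptotic_property_C \<longleftrightarrow>
     (\<forall>R :: nat \<Rightarrow> real. (\<forall>i\<ge>1. 0 < R i) \<and> strict_mono_on {1..} R \<longrightarrow>
        (\<exists>n. \<exists>\<U> :: nat \<Rightarrow> 'a set set.
           (\<forall>i\<in>{1..n}. \<U> i \<subseteq> Pow M \<and> uniformly_bounded (\<U> i) \<and>
              disjoint_at_scale (R i) (\<U> i)) \<and>
           (\<Union>i\<in>{1..n}. \<Union> (\<U> i)) = M))"

end

end

theory Submission
  imports Defs
begin

text \<open>A family that is \<open>2 R\<close>-disjoint has dimension at most \<open>0\<close> at scale \<open>R\<close>, so property C
  gives the right-hand side with all \<open>n\<^sub>i = 0\<close>. Conversely, let \<open>\<V>\<close> have dimension at most \<open>n\<close>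
  at scale \<open>(n + 1) R\<close>. For a point \<open>x\<close> covered by \<open>\<V>\<close> the finite sets
  \<open>F\<^sub>j(x) = {V \<in> \<V>. x \<in> B(V, j R)}\<close>, \<open>j = 0, \<dots>, n + 1\<close>, increase with \<open>j\<close> and have between
  \<open>1\<close> and \<open>n + 1\<close> elements, so \<open>F\<^sub>j(x) = F\<^sub>j\<^sub>+\<^sub>1(x)\<close> for some \<open>j \<le> n\<close>. For fixed \<open>j\<close>, the sets of
  such \<open>x\<close> with a prescribed value of \<open>F\<^sub>j(x)\<close> are \<open>R\<close>-disjoint. Hence \<open>\<V>\<close> can be replaced by
  \<open>n + 1\<close> families that are \<open>R\<close>-disjoint, and these blocks are concatenated.\<close>

section \<open>Multiplicity of families and chains of finite sets\<close>

lemma family_dim_le_iff: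
  "family_dim I A \<le> ereal (real n) \<longleftrightarrow>
     (\<forall>J\<subseteq>I. finite J \<longrightarrow> (\<Inter>j\<in>J. A j) \<noteq> {} \<longrightarrow> card J \<le> n + 1)"
proof
  assume dim: "family_dim I A \<le> ereal (real n)"
  show "\<forall>J\<subseteq>I. finite J \<longrightarrow> (\<Inter>j\<in>J. A j) \<noteq> {} \<longrightarrow> card J \<le> n + 1"
  proof (intro allI impI)
    fix J assume J: "J \<subseteq> I" "(\<Inter>j\<in>J. A j) \<noteq> {}"
    show "card J \<le> n + 1"
    proof (cases "card J")
      case (Suc k)
      then have "ereal (real k) \<le> family_dim I A"
        unfolding family_dim_def using J by (intro Sup_upper) auto
      then show ?thesis
        using order_trans[OF _ dim, of "ereal (real k)"] Suc by simp
    qed simp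
  qed
next
  assume bound: "\<forall>J\<subseteq>I. finite J \<longrightarrow> (\<Inter>j\<in>J. A j) \<noteq> {} \<longrightarrow> card J \<le> n + 1"
  show "family_dim I A \<le> ereal (real n)"
    unfolding family_dim_def
  proof (rule Sup_least, clarify)
    fix k J assume J: "J \<subseteq> I" "card J = k + 1" "(\<Inter>j\<in>J. A j) \<noteq> {}"
    \<comment> \<open>Infinite sets have \<open>card\<close> equal to \<open>0\<close>, so positive
      cardinality forces finiteness.\<close>
    then have "finite J"
      by (intro card_ge_0_finite) simp
    then have "card J \<le> n + 1"
      using bound J(1,3) by blast
    then show "ereal (real k) \<le> ereal (real n)"
      using J(2) by simp
  qed
qed

text \<open>The dimension only controls finite sets of indices, but an infinite set of indices whose
  members contain \<open>x\<close> would have a finite subset with \<open>n + 2\<close>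
  elements.\<close>

lemma family_dim_le_multiplicity:
  assumes "family_dim I A \<le> ereal (real n)"
  shows "finite {i \<in> I. x \<in> A i}" "card {i \<in> I. x \<in> A i} \<le> n + 1"
proof -
  have bound: "card J \<le> n + 1" if "J \<subseteq> {i \<in> I. x \<in> A i}" "finite J" for J
  proof -
    have "J \<subseteq> I" "x \<in> (\<Inter>i\<in>J. A i)"
      using that(1) by auto
    then show ?thesis
      using assms that(2) unfolding family_dim_le_iff by blast
  qed
  show "finite {i \<in> I. x \<in> A i}"
  proof (rule ccontr)
    assume "infinite {i \<in> I. x \<in> A i}"
    then obtain J where "J \<subseteq> {i \<in> I. x \<in> A i}" "finite J" "card J = n + 2"
      using infinite_arbitrarily_large by metis
    then show False
      using bound[of J] by simp
  qed
  then show "card {i \<in> I. x \<in> A i} \<le> n + 1"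
    using bound by blast
qed

text \<open>If all \<open>n + 1\<close> inclusions were strict, the cardinality, which is at least 1
  at the start, would grow to at least \<open>n + 2\<close>.\<close>

lemma increasing_sets_stabilize:
  fixes F :: "nat \<Rightarrow> 'b set"
  assumes mono: "\<And>j. F j \<subseteq> F (Suc j)"
    and "finite (F (Suc n))" "card (F (Suc n)) \<le> n + 1" "F 0 \<noteq> {}"
  obtains j where "j \<le> n" "F j = F (Suc j)"
proof -
  have incr: "F j \<subseteq> F k" if "j \<le> k" for j k
    using mono that by (rule lift_Suc_mono_le)
  then have fin: "finite (F j)" if "j \<le> Suc n" for j
    using that assms(2) finite_subset by blast
  have "\<exists>j\<le>n. F j = F (Suc j)"
  proof (rule ccontr)
    assume "\<not> ?thesis"
    then have strict: "card (F j) < card (F (Suc j))" if "j \<le> n" for j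
      using that mono fin[of "Suc j"] by (intro psubset_card_mono) auto
    have "j < card (F j)" if "j \<le> Suc n" for j
      using that
    proof (induction j)
      case 0
      then show ?case using assms(4) fin[of 0] by (simp add: card_gt_0_iff)
    next
      case (Suc j)
      then show ?case using strict[of j] by simp
    qed
    from this[of "Suc n"] show False
      using assms(3) by simp
  qed
  then show ?thesis
    using that by blast
qed

section \<open>Neighbourhoods, diameters and disjointness at a scale\<close>

context Metric_space
begin

lemma ediameter_le_iff:
  "ediameter U \<le> ereal D \<longleftrightarrow> (\<forall>x\<in>U. \<forall>y\<in>U. d x y \<le> D)"
proof
  assume bound: "ediameter U \<le> ereal D"
  show "\<forall>x\<in>U. \<forall>y\<in>U. d x y \<le> D"
  proof (intro ballI)
    fix x y assume "x \<in> U" "y \<in> U"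
    then have "ereal (d x y) \<le> ediameter U"
      unfolding ediameter_def by (intro Sup_upper) blast
    then show "d x y \<le> D"
      using order_trans[OF _ bound, of "ereal (d x y)"] by simp
  qed
qed (auto simp: ediameter_def intro!: Sup_least)

lemma nbhd_0 [simp]: "nbhd U 0 = U"
  by (auto simp: nbhd_def simp flip: not_le)

lemma nbhd_mono: "r \<le> s \<Longrightarrow> nbhd U r \<subseteq> nbhd U s"
  unfolding nbhd_def by (blast intro: less_le_trans)

text \<open>This is the triangle inequality. Points of \<open>U\<close> are treated apart because
  for \<open>r = 0\<close> they lie in \<open>nbhd U r\<close> without being at distance less than
  \<open>r\<close> from \<open>U\<close>.\<close>

lemma nbhd_add:
  assumes "U \<subseteq> M" "x \<in> nbhd U r" "y \<in> M" "d x y < s" "0 \<le> r"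
  shows "y \<in> nbhd U (r + s)"
proof (cases "x \<in> U")
  case True
  then show ?thesis
    using assms(3-5) commute[of x y] unfolding nbhd_def by (auto intro!: bexI[of _ x])
next
  case False
  then obtain u where u: "u \<in> U" "d x u < r" "x \<in> M"
    using assms(2) by (auto simp: nbhd_def)
  then have "d y u < r + s"
    using assms(1,3,4) triangle[of y x u] commute[of x y] by (smt (verit, best) subsetD)
  then show ?thesis
    using u assms(3) by (auto simp: nbhd_def)
qed

lemma nbhd_bounded:
  assumes "U \<subseteq> M" "\<And>u v. u \<in> U \<Longrightarrow> v \<in> U \<Longrightarrow> d u v \<le> D"
    and "x \<in> nbhd U r" "y \<in> nbhd U r" "0 \<le> r"
  shows "d x y \<le> D + 2 * r"
proof -
  \<comment> \<open>The non-strict bound covers the points of \<open>U\<close> as well, including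
    when \<open>r = 0\<close>.\<close>
  have near: "\<exists>u\<in>U. z \<in> M \<and> d z u \<le> r" if "z \<in> nbhd U r" for z
  proof (cases "z \<in> U")
    case True
    then show ?thesis
      using assms(1,5) by (intro bexI[of _ z]) auto
  next
    case False
    then show ?thesis
      using that by (auto simp: nbhd_def intro: less_imp_le)
  qed
  obtain u v where uv: "u \<in> U" "d x u \<le> r" "v \<in> U" "d y v \<le> r" "x \<in> M" "y \<in> M"
    using near assms(3,4) by blast
  then have "d x y \<le> d x u + d u v + d y v"
    using assms(1) triangle[of x u y] triangle[of u v y] commute[of v y]
    by (smt (verit, best) subsetD)
  then show ?thesis
    using uv assms(2)[of u v] by simp
qed

lemma disjoint_at_scale_mono:
  "disjoint_at_scale S \<U> \<Longrightarrow> R \<le> S \<Longrightarrow> disjoint_at_scale R \<U>"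
  unfolding disjoint_at_scale_def by (blast intro: order_trans)

text \<open>Two members whose \<open>R\<close>-neighbourhoods share a point contain points at
  distance less than \<open>2 * R\<close>, so they coincide.\<close>

lemma disjoint_at_scale_imp_dim_le_0:
  assumes "\<U> \<subseteq> Pow M" "disjoint_at_scale (2 * R) \<U>" "0 < R"
  shows "dim_at_scale R \<U> \<le> ereal (real 0)"
  unfolding dim_at_scale_def family_dim_le_iff
proof (intro allI impI)
  fix J assume J: "J \<subseteq> \<U>" "finite J" "(\<Inter>U\<in>J. nbhd U R) \<noteq> {}"
  then obtain x where x: "\<And>U. U \<in> J \<Longrightarrow> x \<in> nbhd U R"
    by blast
  have near: "\<exists>u\<in>U. x \<in> M \<and> u \<in> M \<and> d x u < R" if "U \<in> J" for U
  proof (cases "x \<in> U")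
    case True
    then show ?thesis
      using that J(1) assms(1,3) by (intro bexI[of _ x]) (auto simp: subset_eq)
  next
    case False
    then show ?thesis
      using x[OF that] that J(1) assms(1) by (auto simp: nbhd_def)
  qed
  have "U = V" if UV: "U \<in> J" "V \<in> J" for U V
  proof (rule ccontr)
    assume "U \<noteq> V"
    obtain u v where uv: "u \<in> U" "v \<in> V" "x \<in> M" "u \<in> M" "v \<in> M" "d x u < R" "d x v < R"
      using near[OF UV(1)] near[OF UV(2)] by blast
    then have "d u v < 2 * R"
      using triangle[of u x v] commute[of x u] by simp
    moreover have "2 * R \<le> d u v"
      using assms(2) UV J(1) \<open>U \<noteq> V\<close> uv(1,2) unfolding disjoint_at_scale_def by blast
    ultimately show False
      by simp
  qed
  then show "card J \<le> 0 + 1"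
    using J(2) by (simp add: card_le_Suc0_iff_eq)
qed

section \<open>Splitting a finite-dimensional family into disjoint families\<close>

lemma disjoint_decomposition:
  assumes \<V>: "\<V> \<subseteq> Pow M" "uniformly_bounded \<V>"
    and dim: "dim_at_scale (real (Suc n) * R) \<V> \<le> ereal (real n)" and "0 < R"
  obtains \<W> :: "nat \<Rightarrow> 'a set set"
  where "\<And>j. \<W> j \<subseteq> Pow M" "\<And>j. uniformly_bounded (\<W> j)" "\<And>j. disjoint_at_scale R (\<W> j)"
    "(\<Union>j\<le>n. \<Union> (\<W> j)) = \<Union> \<V>"
proof
  define F where "F x j = {V \<in> \<V>. x \<in> nbhd V (real j * R)}" for x j
  define piece where "piece j G = {x \<in> \<Union> \<V>. F x j = G \<and> F x (Suc j) = G}" for j G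
  \<comment> \<open>Here \<open>G\<close> ranges over all families of sets. The empty pieces this
    produces are harmless for both boundedness and disjointness.\<close>
  define \<W> where "\<W> j = range (piece j)" for j
  show sub: "\<W> j \<subseteq> Pow M" for j
    using \<V>(1) by (auto simp: \<W>_def piece_def)
  have F_mono: "F x j \<subseteq> F x (Suc j)" for x j
    using nbhd_mono[of "real j * R" "real (Suc j) * R"] \<open>0 < R\<close> by (auto simp: F_def)
  show "uniformly_bounded (\<W> j)" for j
  proof -
    obtain D where D: "\<And>V x y. V \<in> \<V> \<Longrightarrow> x \<in> V \<Longrightarrow> y \<in> V \<Longrightarrow> d x y \<le> D"
      using \<V>(2) unfolding uniformly_bounded_def ediameter_le_iff by blast
    \<comment> \<open>A member \<open>V\<close> containing \<open>x\<close> belongs to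
      \<open>F x j = G = F y j\<close>, so both points are near the same \<open>V\<close>. The bound
      depends on \<open>j\<close> but not on \<open>G\<close>.\<close>
    have "d x y \<le> D + 2 * (real j * R)" if "x \<in> piece j G" "y \<in> piece j G" for x y G
    proof -
      obtain V where V: "V \<in> \<V>" "x \<in> V"
        using \<open>x \<in> piece j G\<close> by (auto simp: piece_def)
      then have "V \<in> F x j"
        by (auto simp: F_def nbhd_def)
      then have "x \<in> nbhd V (real j * R)" "y \<in> nbhd V (real j * R)"
        using that by (auto simp: piece_def F_def)
      then show ?thesis
        using V(1) \<V>(1) D \<open>0 < R\<close> by (intro nbhd_bounded[of V]) auto
    qed
    then show ?thesis
      unfolding uniformly_bounded_def ediameter_le_iff \<W>_def by blast
  qed
  show "disjoint_at_scale R (\<W> j)" for j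
  proof -
    \<comment> \<open>Moving by less than \<open>R\<close> enlarges the radius by one step, so
      \<open>G = F x j \<subseteq> F y (Suc j) = H\<close>. Exchanging \<open>x\<close> and
      \<open>y\<close> then gives \<open>G = H\<close>, so distinct pieces are at least
      \<open>R\<close> apart.\<close>
    have le: "G \<subseteq> H" if "x \<in> piece j G" "y \<in> piece j H" "d x y < R" for x y G H
    proof
      fix V assume "V \<in> G"
      then have V: "V \<in> \<V>" "x \<in> nbhd V (real j * R)"
        using that by (auto simp: piece_def F_def)
      moreover have "y \<in> M"
        using that(2) \<V>(1) by (auto simp: piece_def)
      ultimately have "y \<in> nbhd V (real j * R + R)"
        using that(3) \<V>(1) \<open>0 < R\<close> by (intro nbhd_add[of V x]) auto
      then have "V \<in> F y (Suc j)"
        using V by (simp add: F_def algebra_simps)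
      then show "V \<in> H"
        using that by (simp add: piece_def)
    qed
    have "R \<le> d x y" if "x \<in> piece j G" "y \<in> piece j H" "piece j G \<noteq> piece j H" for x y G H
    proof (rule ccontr)
      assume "\<not> R \<le> d x y"
      then have "G = H"
        using le[OF that(1,2)] le[OF that(2,1)] commute[of x y] by auto
      then show False using that(3) by simp
    qed
    then show ?thesis
      unfolding disjoint_at_scale_def \<W>_def by blast
  qed
  show "(\<Union>j\<le>n. \<Union> (\<W> j)) = \<Union> \<V>"
  proof
    show "(\<Union>j\<le>n. \<Union> (\<W> j)) \<subseteq> \<Union> \<V>"
      by (auto simp: \<W>_def piece_def)
    show "\<Union> \<V> \<subseteq> (\<Union>j\<le>n. \<Union> (\<W> j))"
    proof
      fix x assume x: "x \<in> \<Union> \<V>"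
      \<comment> \<open>At radius \<open>0\<close> the neighbourhood is the set itself, so a member
        containing \<open>x\<close> is in \<open>F x 0\<close>.\<close>
      then have "F x 0 \<noteq> {}"
        by (auto simp: F_def)
      moreover have "finite (F x (Suc n))" "card (F x (Suc n)) \<le> n + 1"
        using family_dim_le_multiplicity[OF dim[unfolded dim_at_scale_def], of x]
        by (simp_all add: F_def)
      ultimately obtain j where "j \<le> n" "F x j = F x (Suc j)"
        using increasing_sets_stabilize[of "F x" n] F_mono by blast
      then have "x \<in> piece j (F x j)"
        using x by (simp add: piece_def)
      then show "x \<in> (\<Union>j\<le>n. \<Union> (\<W> j))"
        using \<open>j \<le> n\<close> by (auto simp: \<W>_def)
    qed
  qed
qed

section \<open>The two implications\<close>

lemma property_C_imp_dim_le_0: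
  fixes R :: "nat \<Rightarrow> real"
  assumes "asymptotic_property_C" "\<forall>i\<ge>1. 0 < R i"
  shows "\<exists>n. \<exists>\<V> :: nat \<Rightarrow> 'a set set.
    (\<forall>i\<in>{1..n}. \<V> i \<subseteq> Pow M \<and> uniformly_bounded (\<V> i) \<and>
       dim_at_scale (R i) (\<V> i) \<le> ereal (real 0)) \<and> (\<Union>i\<in>{1..n}. \<Union> (\<V> i)) = M"
proof -
  \<comment> \<open>The radii \<open>R i\<close> need not increase. Their doubled partial sums do,
    and they dominate \<open>2 * R i\<close>, the scale required for dimension at most 0.\<close>
  define S where "S i = (\<Sum>j=1..i. 2 * R j)" for i
  have S_Suc: "S (Suc i) = S i + 2 * R (Suc i)" for i
    by (simp add: S_def)
  have pos: "0 < R (Suc i)" for i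
    using assms(2) by simp
  have "strict_mono S"
    using S_Suc pos by (simp add: strict_mono_Suc_iff)
  then have mono: "strict_mono_on {1..} S"
    by (simp add: strict_mono_on_def strict_mono_def)
  have S_nonneg: "0 \<le> S i" for i
    unfolding S_def using assms(2) by (intro sum_nonneg) (auto intro: less_imp_le)
  have S_ge: "2 * R i \<le> S i" if "1 \<le> i" for i
    using that S_Suc[of "i - 1"] S_nonneg[of "i - 1"] by simp
  have "\<forall>i\<ge>1. 0 < S i"
    using S_ge assms(2) by fastforce
  then obtain n \<U> where \<U>: "\<forall>i\<in>{1..n}. \<U> i \<subseteq> Pow M \<and> uniformly_bounded (\<U> i) \<and>
      disjoint_at_scale (S i) (\<U> i)" "(\<Union>i\<in>{1..n}. \<Union> (\<U> i)) = M"
    using assms(1) mono unfolding asymptotic_property_C_def by metis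
  have "dim_at_scale (R i) (\<U> i) \<le> ereal (real 0)" if "i \<in> {1..n}" for i
  proof (rule disjoint_at_scale_imp_dim_le_0)
    show "disjoint_at_scale (2 * R i) (\<U> i)"
      using that \<U>(1) S_ge[of i] disjoint_at_scale_mono[of "S i" "\<U> i"] by simp
  qed (use that \<U>(1) assms(2) in auto)
  then show ?thesis
    using \<U> by blast
qed

text \<open>Block \<open>i\<close> consists of the \<open>N i + 1\<close> families obtained from
  \<open>\<V> i\<close> and occupies the indices from \<open>m (i - 1) + 1\<close> to
  \<open>m i\<close>. Splitting at the scale \<open>R (m i)\<close>, the largest in the block,
  serves every index of the block.\<close>

lemma concatenated_decomposition:
  fixes R :: "nat \<Rightarrow> real" and N :: "nat \<Rightarrow> nat"
  defines "m \<equiv> \<lambda>i. \<Sum>j=1..i. Suc (N j)"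
  assumes pos: "\<forall>i\<ge>1. 0 < R i" and mono: "strict_mono_on {1..} R"
    and \<V>: "\<forall>i\<in>{1..n}. \<V> i \<subseteq> Pow M \<and> uniformly_bounded (\<V> i) \<and>
      dim_at_scale (real (Suc (N i)) * R (m i)) (\<V> i) \<le> ereal (real (N i))"
  shows "\<exists>\<U> :: nat \<Rightarrow> 'a set set.
    (\<forall>l\<in>{1..m n}. \<U> l \<subseteq> Pow M \<and> uniformly_bounded (\<U> l) \<and> disjoint_at_scale (R l) (\<U> l)) \<and>
    (\<Union>l\<in>{1..m n}. \<Union> (\<U> l)) = (\<Union>i\<in>{1..n}. \<Union> (\<V> i))"
  using \<V>
proof (induction n)
  case 0
  then show ?case by (simp add: m_def)
next
  case (Suc n)
  have m_Suc: "m (Suc n) = m n + Suc (N (Suc n))"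
    by (simp add: m_def)
  obtain \<U> where \<U>: "\<forall>l\<in>{1..m n}. \<U> l \<subseteq> Pow M \<and> uniformly_bounded (\<U> l) \<and>
      disjoint_at_scale (R l) (\<U> l)" "(\<Union>l\<in>{1..m n}. \<Union> (\<U> l)) = (\<Union>i\<in>{1..n}. \<Union> (\<V> i))"
    using Suc by force
  have "0 < R (m (Suc n))"
    using pos m_Suc by simp
  moreover have "\<V> (Suc n) \<subseteq> Pow M" "uniformly_bounded (\<V> (Suc n))"
    "dim_at_scale (real (Suc (N (Suc n))) * R (m (Suc n))) (\<V> (Suc n)) \<le> ereal (real (N (Suc n)))"
    using Suc.prems by simp_all
  ultimately obtain \<W> where \<W>: "\<And>j. \<W> j \<subseteq> Pow M" "\<And>j. uniformly_bounded (\<W> j)"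
    "\<And>j. disjoint_at_scale (R (m (Suc n))) (\<W> j)"
    "(\<Union>j\<le>N (Suc n). \<Union> (\<W> j)) = \<Union> (\<V> (Suc n))"
    using disjoint_decomposition by metis
  \<comment> \<open>The new block starts at \<open>Suc (m n)\<close>, while the families
    \<open>\<W> j\<close> are numbered from \<open>0\<close>.\<close>
  define \<U>' where "\<U>' l = (if l \<le> m n then \<U> l else \<W> (l - Suc (m n)))" for l
  have "\<U>' l \<subseteq> Pow M \<and> uniformly_bounded (\<U>' l) \<and> disjoint_at_scale (R l) (\<U>' l)"
    if "l \<in> {1..m (Suc n)}" for l
  proof (cases "l \<le> m n")
    case True
    then show ?thesis using \<U>(1) that by (simp add: \<U>'_def)
  next
    case False
    have "R l \<le> R (m (Suc n))"
      using that strict_mono_on_leD[OF mono, of l "m (Suc n)"] by simp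
    then show ?thesis
      using False \<W>(1,2) disjoint_at_scale_mono[OF \<W>(3)] by (simp add: \<U>'_def)
  qed
  moreover have "(\<Union>l\<in>{1..m (Suc n)}. \<Union> (\<U>' l)) = (\<Union>i\<in>{1..Suc n}. \<Union> (\<V> i))"
  proof -
    have "{1..m (Suc n)} = {1..m n} \<union> (\<lambda>j. j + Suc (m n)) ` {0..N (Suc n)}"
      unfolding image_add_atLeastAtMost' m_Suc by auto
    then have "(\<Union>l\<in>{1..m (Suc n)}. \<Union> (\<U>' l)) =
        (\<Union>l\<in>{1..m n}. \<Union> (\<U>' l)) \<union> (\<Union>j\<in>{0..N (Suc n)}. \<Union> (\<U>' (j + Suc (m n))))"
      by (simp add: image_image UN_Un)
    also have "\<dots> = (\<Union>l\<in>{1..m n}. \<Union> (\<U> l)) \<union> (\<Union>j\<le>N (Suc n). \<Union> (\<W> j))"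
      by (simp add: \<U>'_def atLeast0AtMost)
    also have "\<dots> = (\<Union>i\<in>{1..Suc n}. \<Union> (\<V> i))"
      unfolding \<U>(2) \<W>(4) by (simp add: atLeastAtMostSuc_conv Un_commute)
    finally show ?thesis .
  qed
  ultimately show ?case
    by blast
qed

end

theorem theorem2p9:
  fixes M :: "'a set" and d :: "'a \<Rightarrow> 'a \<Rightarrow> real"
  assumes "Metric_space M d"
  shows "Metric_space.asymptotic_property_C M d \<longleftrightarrow>
    (\<exists>N :: nat \<Rightarrow> nat. \<forall>R :: nat \<Rightarrow> real. (\<forall>i\<ge>1. 0 < R i) \<longrightarrow>
       (\<exists>n. \<exists>\<V> :: nat \<Rightarrow> 'a set set.
          (\<forall>i\<in>{1..n}. \<V> i \<subseteq> Pow M \<and> Metric_space.uniformly_bounded d (\<V> i) \<and>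
             Metric_space.dim_at_scale M d (R i) (\<V> i) \<le> ereal (real (N i))) \<and>
          (\<Union>i\<in>{1..n}. \<Union> (\<V> i)) = M))"
    (is "?C \<longleftrightarrow> (\<exists>N. \<forall>R. ?pos R \<longrightarrow> ?cover N R)")
proof -
  interpret Metric_space M d by (rule assms)
  show ?thesis
  proof
    assume ?C
    then have "\<forall>R. ?pos R \<longrightarrow> ?cover (\<lambda>i. 0) R"
      using property_C_imp_dim_le_0 by blast
    then show "\<exists>N. \<forall>R. ?pos R \<longrightarrow> ?cover N R"
      by (rule exI[of _ "\<lambda>i. 0"])
  next
    assume "\<exists>N. \<forall>R. ?pos R \<longrightarrow> ?cover N R"
    then obtain N where N: "\<forall>R. ?pos R \<longrightarrow> ?cover N R" ..
    show ?C
      unfolding asymptotic_property_C_def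
    proof (intro allI impI, elim conjE)
      fix R :: "nat \<Rightarrow> real"
      assume pos: "\<forall>i\<ge>1. 0 < R i" and mono: "strict_mono_on {1..} R"
      define m where "m i = (\<Sum>j=1..i. Suc (N j))" for i
      \<comment> \<open>The value \<open>R 0\<close> is unconstrained, so positivity of
        \<open>R (m i)\<close> requires a positive index.\<close>
      have "1 \<le> m i" if "1 \<le> i" for i
        using that by (cases i) (simp_all add: m_def)
      then have "\<forall>i\<ge>1. 0 < real (Suc (N i)) * R (m i)"
        using pos by simp
      \<comment> \<open>Since \<open>N\<close> is fixed before the radii, the radii may be defined
        in terms of \<open>N\<close> through the factor \<open>Suc (N i)\<close> and the block ends
        \<open>m i\<close>.\<close>
      then obtain n \<V> where \<V>: "\<forall>i\<in>{1..n}. \<V> i \<subseteq> Pow M \<and> uniformly_bounded (\<V> i) \<and>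
          dim_at_scale (real (Suc (N i)) * R (m i)) (\<V> i) \<le> ereal (real (N i))"
        "(\<Union>i\<in>{1..n}. \<Union> (\<V> i)) = M"
        using N[rule_format, of "\<lambda>i. real (Suc (N i)) * R (m i)"] by auto
      show "\<exists>n. \<exists>\<U> :: nat \<Rightarrow> 'a set set.
          (\<forall>i\<in>{1..n}. \<U> i \<subseteq> Pow M \<and> uniformly_bounded (\<U> i) \<and>
             disjoint_at_scale (R i) (\<U> i)) \<and> (\<Union>i\<in>{1..n}. \<Union> (\<U> i)) = M"
        using concatenated_decomposition[OF pos mono \<V>(1)[unfolded m_def]] \<V>(2) by metis
    qed
  qed
qed

end
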